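(* There exists an absolute constant $A<\infty$ such that $C_{w,T}(Q)\le A\,Q$ for every $Q\ge1$; that is, for every weight $w$ on $\mathbb{R}$ with $[w]_{A_2}\le Q$, every $I\in\mathcal{D}$ and every $\lambda>0$, $$\frac{1}{|I|}\,w\Big\{x\in I:\ \sum_{J\in\mathcal{D}(I)}|\Delta_Jw^{-1}|^2\,\mathbf 1_J(x)>\lambda\Big\}\le A\,Q\,\frac{\langle w^{-1}\rangle_I}{\lambda}.$$ Moreover this estimate is sharp in its order of growth: there is an absolute constant $c>0$ such that $C_{w,T}(Q)\ge c\,Q$ for all sufficiently large $Q$.
   Context: $\mathcal{D}$ is the family of standard dyadic intervals of $\mathbb{R}$, and for $I\in\mathcal{D}$, $\mathcal{D}(I)$ is the family of all $J\in\mathcal{D}$ with $J\subset I$ (including $I$). For $J\in\mathcal{D}$, $J_+$ and $J_-$ are its two dyadic children (halves), and $\langle f\rangle_J=\frac1{|J|}\int_J f\,dx$. The martingale difference is $\Delta_J f=\frac12\big[(\langle f\rangle_{J_+}-\langle f\rangle_{J_-})\mathbf 1_{J_+}+(\langle f\rangle_{J_-}-\langle f\rangle_{J_+})\mathbf 1_{J_-}\big]$, so $|\Delta_J f|$ is constant on $J$. A weight is a positive locally integrable function $w$ with $w^{-1}$ locally integrable, (dyadic $A_2$) $[w]_{A_2}=\sup_{J\in\mathcal{D}}\langle w\rangle_J\langle w^{-1}\rangle_J$, and $w(E)=w\,E=\int_Ew\,dx$. $C_{w,T}(Q)$ denotes the smallest constant $C$ such that $\frac{1}{|I|}w\{x\in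 I:\sum_{J\in\mathcal{D}(I)}|\Delta_Jw^{-1}|^2\mathbf 1_J(x)>\lambda\}\le C\frac{\langle w^{-1}\rangle_I}{\lambda}$ for all weights $w$ with $[w]_{A_2}\le Q$, all $I\in\mathcal{D}$ and all $\lambda>0$. *)

theory Defs
  imports "HOL-Analysis.Analysis"
begin

text \<open>All integrals are with respect to Lebesgue measure on the real line.\<close>

definition dyadic_intervals :: "real set set" where
  "dyadic_intervals =
     {J. \<exists>(n::int) (k::int). J = {of_int k * 2 powi n ..< (of_int k + 1) * 2 powi n}}"

definition dyadic_sub :: "real set \<Rightarrow> real set set" where
  "dyadic_sub I = {J \<in> dyadic_intervals. J \<subseteq> I}"

text \<open>The two halves of a half-open interval \<open>J\<close>, whose end points are \<open>Inf J\<close> and \<open>Sup J\<close>.\<close>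

definition child_minus :: "real set \<Rightarrow> real set" where
  "child_minus J = {Inf J ..< (Inf J + Sup J) / 2}"

definition child_plus :: "real set \<Rightarrow> real set" where
  "child_plus J = {(Inf J + Sup J) / 2 ..< Sup J}"

definition average :: "(real \<Rightarrow> real) \<Rightarrow> real set \<Rightarrow> real" where
  "average f J = (1 / measure lebesgue J) * (LINT x:J|lebesgue. f x)"

definition mart_diff :: "(real \<Rightarrow> real) \<Rightarrow> real set \<Rightarrow> real \<Rightarrow> real" where
  "mart_diff f J x =
     1/2 * ((average f (child_plus J) - average f (child_minus J)) * indicator (child_plus J) x
          + (average f (child_minus J) - average f (child_plus J)) * indicator (child_minus J) x)"

definition locally_integrable :: "(real \<Rightarrow> real) \<Rightarrow> bool" where
  "locally_integrable f \<longleftrightarrow> (\<forall>K. compact K \<longrightarrow> f absolutely_integrable_on K)"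

definition weight :: "(real \<Rightarrow> real) \<Rightarrow> bool" where
  "weight w \<longleftrightarrow> (\<forall>x. 0 < w x) \<and> locally_integrable w \<and> locally_integrable (\<lambda>x. inverse (w x))"

text \<open>The characteristic is infinite if \<open>w\<close> is not a dyadic \<open>A\<^sub>2\<close> weight.\<close>

definition A2_char :: "(real \<Rightarrow> real) \<Rightarrow> ennreal" where
  "A2_char w = (SUP J\<in>dyadic_intervals. ennreal (average w J * average (\<lambda>x. inverse (w x)) J))"

definition weighted_measure :: "(real \<Rightarrow> real) \<Rightarrow> real set \<Rightarrow> ennreal" where
  "weighted_measure w E = (\<integral>\<^sup>+x\<in>E. ennreal (w x) \<partial>lebesgue)"

text \<open>The sum has nonnegative terms and is taken in \<open>[0, \<infinity>]\<close>, so no summability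
  assumption is needed.\<close>

definition square_sum :: "(real \<Rightarrow> real) \<Rightarrow> real set \<Rightarrow> real \<Rightarrow> ennreal" where
  "square_sum f I x =
     (\<Sum>\<^sub>\<infinity>J\<in>dyadic_sub I. ennreal (\<bar>mart_diff f J x\<bar>\<^sup>2 * indicator J x))"

definition weak_type_bound :: "ennreal \<Rightarrow> (real \<Rightarrow> real) \<Rightarrow> real set \<Rightarrow> real \<Rightarrow> bool" where
  "weak_type_bound C w I l \<longleftrightarrow>
     weighted_measure w {x \<in> I. square_sum (\<lambda>x. inverse (w x)) I x > ennreal l}
        / emeasure lebesgue I
      \<le> C * ennreal (average (\<lambda>x. inverse (w x)) I / l)"

text \<open>The infimum is attained: the set of admissible constants is closed in \<open>[0, \<infinity>]\<close>
  and contains \<open>\<infinity>\<close>, so this is the smallest admissible constant.\<close>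

definition C_wT :: "real \<Rightarrow> ennreal" where
  "C_wT Q = Inf {C. \<forall>w. weight w \<and> A2_char w \<le> ennreal Q \<longrightarrow>
                     (\<forall>I\<in>dyadic_intervals. \<forall>l>0. weak_type_bound C w I l)}"

end

theory Submission
  imports Defs
begin

text \<open>Write \<open>u = 1/w\<close> and let \<open>a\<close> be the square sum accumulated from \<open>I\<close> down to \<open>J\<close>. If the
  average of \<open>u\<close> over \<open>J\<close> reaches \<open>\<surd>\<lambda>\<close>, the \<open>A\<^sub>2\<close> condition bounds \<open>w(J)/|J|\<close> by
  \<open>Q \<langle>u\<rangle>\<^sub>J / \<lambda>\<close>, and such maximal \<open>J\<close> contribute at most \<open>Q u(I) / \<lambda>\<close>. Elsewhere one integrates
  the square of the square sum against \<open>w\<close>: a step of size \<open>d\<close> at \<open>J\<close> costs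
  \<open>(2 a d\<^sup>2 + d\<^sup>4) \<langle>w\<rangle>\<^sub>J \<le> (2 a d\<^sup>2 + d\<^sup>4) Q / \<langle>u\<rangle>\<^sub>J\<close>, and this is paid for by the decrease of an
  explicit Bellman function of \<open>\<langle>u\<rangle>\<^sub>J\<close> and \<open>a\<close>. (Integrating the square sum itself would lose a
  logarithm.) For sharpness, take a weight equal to \<open>\<surd>Q\<close> left of \<open>1/2\<close> and \<open>1/\<surd>Q\<close> right of it:
  on \<open>[0,1)\<close> the first martingale difference alone has size comparable to \<open>\<langle>u\<rangle>\<close>.\<close>

section \<open>Dyadic generations\<close>

lemma dyadic_cases:
  assumes "J \<in> dyadic_intervals"
  obtains k n :: int where "J = {of_int k * 2 powi n ..< (of_int k + 1) * 2 powi n}"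
  using assms unfolding dyadic_intervals_def by blast

lemma dyadic_interval:
  assumes "J \<in> dyadic_intervals"
  obtains a b where "a < b" "J = {a..<b}" "child_minus J = {a..<(a+b)/2}"
    "child_plus J = {(a+b)/2..<b}"
proof -
  obtain k n :: int where J: "J = {of_int k * 2 powi n ..< (of_int k + 1) * 2 powi n}"
    using assms by (rule dyadic_cases)
  have "(of_int k :: real) * 2 powi n < (of_int k + 1) * 2 powi n"
    by simp
  with J show thesis
    by (intro that) (auto simp: child_minus_def child_plus_def)
qed

lemma children_dyadic:
  assumes "J \<in> dyadic_intervals"
  shows "child_minus J \<in> dyadic_intervals" "child_plus J \<in> dyadic_intervals"
proof -
  obtain k n :: int where J: "J = {of_int k * 2 powi n ..< (of_int k + 1) * 2 powi n}"
    using assms by (rule dyadic_cases)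
  have lt: "(of_int k :: real) * 2 powi n < (of_int k + 1) * 2 powi n"
    by simp
  have pn: "(2::real) powi n = 2 * 2 powi (n - 1)"
    using power_int_add_1'[of "2::real" "n - 1"] by simp
  have "child_minus J = {of_int (2*k) * 2 powi (n-1) ..< (of_int (2*k) + 1) * 2 powi (n-1)}"
    using lt unfolding child_minus_def J by (simp add: pn algebra_simps add_divide_distrib)
  then show "child_minus J \<in> dyadic_intervals"
    unfolding dyadic_intervals_def by blast
  have "child_plus J = {of_int (2*k+1) * 2 powi (n-1) ..< (of_int (2*k+1) + 1) * 2 powi (n-1)}"
    using lt unfolding child_plus_def J by (simp add: pn algebra_simps add_divide_distrib)
  then show "child_plus J \<in> dyadic_intervals"
    unfolding dyadic_intervals_def by blast
qed

lemma children_partition: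
  assumes "J \<in> dyadic_intervals"
  shows "child_minus J \<union> child_plus J = J" "child_minus J \<inter> child_plus J = {}"
proof -
  obtain a b where "a < b" "J = {a..<b}" "child_minus J = {a..<(a+b)/2}"
      "child_plus J = {(a+b)/2..<b}"
    using assms by (rule dyadic_interval)
  then show "child_minus J \<union> child_plus J = J" "child_minus J \<inter> child_plus J = {}"
    by auto
qed

lemma dyadic_sets:
  assumes "J \<in> dyadic_intervals"
  shows "J \<in> sets lebesgue" "J \<noteq> {}" "0 < measure lebesgue J"
    "emeasure lebesgue J = ennreal (measure lebesgue J)"
proof -
  obtain a b where "a < b" "J = {a..<b}" "child_minus J = {a..<(a+b)/2}"
      "child_plus J = {(a+b)/2..<b}"
    using assms by (rule dyadic_interval)
  then show "J \<in> sets lebesgue" "J \<noteq> {}" "0 < measure lebesgue J"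
    "emeasure lebesgue J = ennreal (measure lebesgue J)"
    by simp_all
qed

lemma measure_children:
  assumes "J \<in> dyadic_intervals"
  shows "measure lebesgue (child_minus J) = measure lebesgue J / 2"
    "measure lebesgue (child_plus J) = measure lebesgue J / 2"
proof -
  obtain a b where "a < b" "J = {a..<b}" "child_minus J = {a..<(a+b)/2}"
      "child_plus J = {(a+b)/2..<b}"
    using assms by (rule dyadic_interval)
  then show "measure lebesgue (child_minus J) = measure lebesgue J / 2"
    "measure lebesgue (child_plus J) = measure lebesgue J / 2"
    by (simp_all add: field_simps)
qed

text \<open>A dyadic interval shorter than \<open>J\<close> has its end points on a grid that
  contains the midpoint of \<open>J\<close>, so inside \<open>J\<close> it cannot straddle that
  midpoint. Every induction over generations rests on this.\<close>

lemma dyadic_sub_split: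
  assumes "J \<in> dyadic_intervals"
  shows "dyadic_sub J = insert J (dyadic_sub (child_minus J) \<union> dyadic_sub (child_plus J))"
proof
  show "insert J (dyadic_sub (child_minus J) \<union> dyadic_sub (child_plus J)) \<subseteq> dyadic_sub J"
    using assms children_partition[OF assms] by (auto simp: dyadic_sub_def)
  show "dyadic_sub J \<subseteq> insert J (dyadic_sub (child_minus J) \<union> dyadic_sub (child_plus J))"
  proof
    fix K assume "K \<in> dyadic_sub J"
    then have K: "K \<in> dyadic_intervals" and KJ: "K \<subseteq> J"
      by (auto simp: dyadic_sub_def)
    obtain k n :: int where J: "J = {of_int k * 2 powi n ..< (of_int k + 1) * 2 powi n}"
      using assms by (rule dyadic_cases)
    obtain m p :: int where Kp: "K = {of_int m * 2 powi p ..< (of_int m + 1) * 2 powi p}"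
      using K by (rule dyadic_cases)
    have lt: "(of_int k :: real) * 2 powi n < (of_int k + 1) * 2 powi n"
      by simp
    have ltK: "(of_int m :: real) * 2 powi p < (of_int m + 1) * 2 powi p"
      by simp
    have le: "(of_int k :: real) * 2 powi n \<le> of_int m * 2 powi p"
        "(of_int m + 1 :: real) * 2 powi p \<le> (of_int k + 1) * 2 powi n"
      using KJ ltK unfolding J Kp by (simp_all add: ivl_subset)
    then have "(2::real) powi p \<le> 2 powi n"
      by (simp add: algebra_simps)
    then have "p \<le> n"
      using power_int_strict_increasing[of n p "2::real"] by linarith
    show "K \<in> insert J (dyadic_sub (child_minus J) \<union> dyadic_sub (child_plus J))"
    proof (cases "p = n")
      case True
      then have "m = k"
        using le by simp
      with True show ?thesis
        using J Kp by simp
    next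
      case False
      \<comment> \<open>\<open>M\<close> is the position of the midpoint of \<open>J\<close> in
        units of \<open>2 powi p\<close>; it is an integer because \<open>p < n\<close>.\<close>
      define M where "M = (2 * k + 1) * 2 ^ nat (n - 1 - p)"
      have "(2::real) powi n = 2 * 2 powi (n - 1)"
        using power_int_add_1'[of "2::real" "n - 1"] by simp
      moreover have "(2::real) powi (n - 1) = 2 ^ nat (n - 1 - p) * 2 powi p"
      proof -
        have "(2::real) ^ nat (n - 1 - p) = 2 powi (n - 1 - p)"
          using \<open>p \<le> n\<close> False by (simp add: power_int_def)
        then show ?thesis
          using power_int_add[of "2::real" "n - 1 - p" p] by simp
      qed
      ultimately have mid: "(of_int k * 2 powi n + (of_int k + 1) * 2 powi n) / 2 = (of_int M :: real) * 2 powi p"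
        unfolding M_def by (simp add: algebra_simps)
      consider "m + 1 \<le> M" | "M \<le> m"
        by linarith
      then show ?thesis
      proof cases
        case 1
        then have "of_int m + 1 \<le> (of_int M :: real)"
          by linarith
        then have "(of_int m + 1) * 2 powi p \<le> (of_int M :: real) * 2 powi p"
          by (intro mult_right_mono) auto
        then have "K \<subseteq> child_minus J"
          using lt le mid unfolding child_minus_def J Kp by auto
        then show ?thesis
          using K by (auto simp: dyadic_sub_def)
      next
        case 2
        then have "(of_int M :: real) * 2 powi p \<le> of_int m * 2 powi p"
          by (intro mult_right_mono) auto
        then have "K \<subseteq> child_plus J"
          using lt le mid unfolding child_plus_def J Kp by auto
        then show ?thesis
          using K by (auto simp: dyadic_sub_def)
      qed
    qed
  qed
qed

text \<open>Length encodes depth: the strict inequality selects depths \<open>0\<close> to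
  \<open>N - 1\<close> below \<open>J\<close>, so \<open>N\<close> counts levels and
  \<open>N = 0\<close> selects nothing.\<close>

definition generations :: "nat \<Rightarrow> real set \<Rightarrow> real set set" where
  "generations N J = {K \<in> dyadic_sub J. measure lebesgue J < 2 ^ N * measure lebesgue K}"

lemma generations_0:
  assumes "J \<in> dyadic_intervals"
  shows "generations 0 J = {}"
proof -
  have "measure lebesgue K \<le> measure lebesgue J" if "K \<in> dyadic_sub J" for K
  proof (rule measure_mono_fmeasurable)
    show "K \<subseteq> J" "K \<in> sets lebesgue"
      using that dyadic_sets by (auto simp: dyadic_sub_def)
    show "J \<in> lmeasurable"
      using dyadic_sets[OF assms] by (intro fmeasurableI) simp_all
  qed
  then show ?thesis
    by (force simp: generations_def)
qed

lemma generations_Suc: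
  assumes "J \<in> dyadic_intervals"
  shows "generations (Suc N) J = insert J (generations N (child_minus J) \<union> generations N (child_plus J))"
proof -
  have "measure lebesgue J < 2 ^ Suc N * measure lebesgue J"
    using dyadic_sets(3)[OF assms] one_less_power[of "2::real" "Suc N"] by simp
  then show ?thesis
    unfolding generations_def dyadic_sub_split[OF assms]
    using measure_children[OF assms] by (auto simp: field_simps)
qed

lemma finite_generations: "J \<in> dyadic_intervals \<Longrightarrow> finite (generations N J)"
  by (induction N arbitrary: J) (simp_all add: generations_0 generations_Suc children_dyadic)

lemma generations_mono: "M \<le> N \<Longrightarrow> generations M J \<subseteq> generations N J"
proof -
  assume "M \<le> N"
  then have "(2::real) ^ M * measure lebesgue K \<le> 2 ^ N * measure lebesgue K" for K :: "real set"
    by (intro mult_right_mono power_increasing) auto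
  then show ?thesis
    by (force simp: generations_def intro: less_le_trans)
qed

lemma finite_subset_generations:
  assumes "finite F" "F \<subseteq> dyadic_sub J"
  shows "\<exists>N. F \<subseteq> generations N J"
  using assms
proof (induction F)
  case empty
  then show ?case by simp
next
  case (insert K F)
  then obtain N where N: "F \<subseteq> generations N J"
    by auto
  have "0 < measure lebesgue K"
    using insert.prems dyadic_sets(3) by (auto simp: dyadic_sub_def)
  moreover obtain M where "measure lebesgue J / measure lebesgue K < 2 ^ M"
    using real_arch_pow[of 2] by auto
  ultimately have "K \<in> generations M J"
    using insert.prems by (auto simp: generations_def field_simps)
  then have "insert K F \<subseteq> generations (max M N) J"
    using N generations_mono[of M "max M N" J] generations_mono[of N "max M N" J] by auto
  then show ?case ..
qed

section \<open>Truncated square sums\<close>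

definition partial_sum :: "(real \<Rightarrow> real) \<Rightarrow> nat \<Rightarrow> real set \<Rightarrow> real \<Rightarrow> real" where
  "partial_sum f N J x = (\<Sum>K\<in>generations N J. \<bar>mart_diff f K x\<bar>\<^sup>2 * indicator K x)"

lemma partial_sum_outside:
  assumes "x \<notin> J"
  shows "partial_sum f N J x = 0"
  unfolding partial_sum_def
  using assms by (intro sum.neutral) (auto simp: generations_def dyadic_sub_def indicator_def)

text \<open>The martingale difference has constant modulus on \<open>J\<close>, and the remaining
  intervals split between the two children. Only the child containing \<open>x\<close> contributes;
  adding both keeps the recursion free of cases.\<close>

lemma partial_sum_Suc:
  assumes J: "J \<in> dyadic_intervals" and x: "x \<in> J"
  shows "partial_sum f (Suc N) J x = ((average f (child_plus J) - average f (child_minus J)) / 2)\<^sup>2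
    + partial_sum f N (child_minus J) x + partial_sum f N (child_plus J) x"
proof -
  note ch = children_dyadic[OF J]
  note pt = children_partition[OF J]
  have disj: "generations N (child_minus J) \<inter> generations N (child_plus J) = {}"
  proof -
    have False if "K \<in> dyadic_sub (child_minus J)" "K \<in> dyadic_sub (child_plus J)" for K
      using that pt dyadic_sets(2)[of K] by (auto simp: dyadic_sub_def)
    then show ?thesis
      by (auto simp: generations_def)
  qed
  have nin: "J \<notin> generations N (child_minus J) \<union> generations N (child_plus J)"
    using pt dyadic_sets(2)[OF ch(1)] dyadic_sets(2)[OF ch(2)]
    by (auto simp: generations_def dyadic_sub_def)
  have "\<bar>mart_diff f J x\<bar>\<^sup>2 = ((average f (child_plus J) - average f (child_minus J)) / 2)\<^sup>2"
    using x pt by (auto simp: mart_diff_def indicator_def power2_eq_square field_simps)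
  moreover have "partial_sum f (Suc N) J x = \<bar>mart_diff f J x\<bar>\<^sup>2 * indicator J x
      + (partial_sum f N (child_minus J) x + partial_sum f N (child_plus J) x)"
    using nin unfolding partial_sum_def generations_Suc[OF J]
    by (simp add: finite_generations ch disj sum.union_disjoint del: sum_mult_indicator)
  ultimately show ?thesis
    using x by simp
qed

lemma partial_sum_measurable [measurable]:
  assumes "J \<in> dyadic_intervals"
  shows "partial_sum f N J \<in> borel_measurable lebesgue"
  unfolding partial_sum_def[abs_def]
proof (rule borel_measurable_sum)
  fix K assume "K \<in> generations N J"
  then have K: "K \<in> dyadic_intervals"
    by (auto simp: generations_def dyadic_sub_def)
  have [measurable]: "K \<in> sets lebesgue" "child_minus K \<in> sets lebesgue" "child_plus K \<in> sets lebesgue"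
    using K children_dyadic dyadic_sets by auto
  show "(\<lambda>x. \<bar>mart_diff f K x\<bar>\<^sup>2 * indicator K x) \<in> borel_measurable lebesgue"
    unfolding mart_diff_def by measurable
qed

text \<open>The unordered sum is the supremum of its finite subsums, and each finite family of
  subintervals lies in some truncation. Hence a strict excess over the level is already visible at a
  finite depth.\<close>

lemma square_sum_gt_imp:
  assumes I: "I \<in> dyadic_intervals" and l: "0 \<le> l" and "square_sum f I x > ennreal l"
  shows "\<exists>N. partial_sum f N I x > l"
proof -
  define g where "g K = \<bar>mart_diff f K x\<bar>\<^sup>2 * indicator K x" for K
  have g: "0 \<le> g K" for K
    by (simp add: g_def)
  have "ennreal l < (SUP F\<in>{F. finite F \<and> F \<subseteq> dyadic_sub I}. \<Sum>K\<in>F. ennreal (g K))"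
    using assms(3) unfolding square_sum_def g_def[symmetric]
    by (subst (asm) nonneg_infsum_complete) auto
  then obtain F where F: "finite F" "F \<subseteq> dyadic_sub I" "ennreal l < (\<Sum>K\<in>F. ennreal (g K))"
    by (auto simp: less_SUP_iff)
  then have "l < (\<Sum>K\<in>F. g K)"
    using g l by (simp add: sum_ennreal ennreal_less_iff)
  moreover obtain N where "F \<subseteq> generations N I"
    using finite_subset_generations[OF F(1,2)] by blast
  then have "(\<Sum>K\<in>F. g K) \<le> partial_sum f N I x"
    unfolding partial_sum_def g_def[symmetric]
    using g finite_generations[OF I] by (intro sum_mono2) auto
  ultimately show ?thesis
    using less_le_trans by blast
qed

text \<open>The sharpness example uses only this top term, which is a one-element subsum.\<close>

lemma square_sum_ge:
  assumes "I \<in> dyadic_intervals"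
  shows "square_sum f I x \<ge> ennreal (\<bar>mart_diff f I x\<bar>\<^sup>2 * indicator I x)"
proof -
  define g where "g K = ennreal (\<bar>mart_diff f K x\<bar>\<^sup>2 * indicator K x)" for K
  have "{I} \<in> {F. finite F \<and> F \<subseteq> dyadic_sub I}"
    using assms by (auto simp: dyadic_sub_def)
  then have "sum g {I} \<le> (SUP F\<in>{F. finite F \<and> F \<subseteq> dyadic_sub I}. sum g F)"
    by (rule SUP_upper)
  also have "\<dots> = square_sum f I x"
    unfolding square_sum_def g_def[symmetric] by (subst nonneg_infsum_complete) auto
  finally show ?thesis
    by (simp add: g_def del: sum_mult_indicator)
qed

section \<open>The Bellman function\<close>

text \<open>Quantitative concavity of the root. For the roots \<open>p\<close>, \<open>q\<close>,
  \<open>r\<close> of \<open>s + d\<close>, \<open>s - d\<close>, \<open>s\<close>, the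
  parallelogram identity shows that the gap \<open>2 * r - (p + q)\<close> is at least
  \<open>(p - q)\<^sup>2 / (4 * r)\<close>. From \<open>2 * d = (p - q) * (p + q)\<close> and
  \<open>p + q \<le> 2 * r\<close> it follows that \<open>(p - q)\<^sup>2\<close> is at least
  \<open>d\<^sup>2 / r\<^sup>2\<close>.\<close>

lemma sqrt_midpoint:
  fixes s d :: real
  assumes "0 < s" "\<bar>d\<bar> \<le> s"
  shows "(sqrt (s + d) + sqrt (s - d)) / 2 \<le> sqrt s - d\<^sup>2 / (8 * (s * sqrt s))"
proof -
  define p q r where "p = sqrt (s + d)" and "q = sqrt (s - d)" and "r = sqrt s"
  have nn: "0 \<le> p" "0 \<le> q" "0 < r"
    using assms by (auto simp: p_def q_def r_def)
  have sq: "p\<^sup>2 = s + d" "q\<^sup>2 = s - d" "r\<^sup>2 = s"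
    using assms by (auto simp: p_def q_def r_def)
  have a1: "(p + q)\<^sup>2 + (p - q)\<^sup>2 = (2 * r)\<^sup>2"
    using sq by (simp add: power2_eq_square algebra_simps)
  have "(p + q)\<^sup>2 \<le> (2 * r)\<^sup>2"
    using a1 zero_le_power2[of "p - q"] by linarith
  then have le: "p + q \<le> 2 * r"
    by (rule power2_le_imp_le) (use nn in simp)
  have "(2 * d)\<^sup>2 = (p - q)\<^sup>2 * (p + q)\<^sup>2"
  proof -
    have "2 * d = (p - q) * (p + q)"
      using sq by (simp add: power2_eq_square algebra_simps)
    then show ?thesis
      by (simp add: power_mult_distrib)
  qed
  also have "\<dots> \<le> (p - q)\<^sup>2 * (2 * r)\<^sup>2"
    using le nn by (intro mult_left_mono power_mono) auto
  finally have d: "d\<^sup>2 \<le> (p - q)\<^sup>2 * r\<^sup>2"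
    by (simp add: power_mult_distrib)
  have "(p - q)\<^sup>2 = (2 * r - (p + q)) * (2 * r + (p + q))"
    using a1 by (simp add: power2_eq_square algebra_simps)
  also have "\<dots> \<le> (2 * r - (p + q)) * (4 * r)"
    using le by (intro mult_left_mono) auto
  finally have "(p - q)\<^sup>2 * r\<^sup>2 \<le> (2 * r - (p + q)) * (4 * r) * r\<^sup>2"
    by (intro mult_right_mono) auto
  with d have "d\<^sup>2 \<le> (2 * r - (p + q)) * (4 * (s * r))"
    using sq by (simp add: mult_ac)
  then have "d\<^sup>2 / (4 * (s * r)) \<le> 2 * r - (p + q)"
    using assms nn by (simp add: pos_divide_le_eq)
  then show ?thesis
    unfolding p_def q_def r_def by (simp add: field_simps)
qed

text \<open>In midpoint steps from \<open>s\<close> to \<open>s \<plusminus> d\<close> and from \<open>a\<close> to \<open>a + d\<^sup>2\<close>, the term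
  \<open>16 a \<surd>s\<close> loses at least \<open>2 a d\<^sup>2 / s\<close> by concavity of the root, but gains up to \<open>16 d\<^sup>2\<close>
  because \<open>a\<close> increases. The term \<open>- 17 s\<^sup>2\<close> pays for this gain and for \<open>d\<^sup>4 / s \<le> d\<^sup>2\<close>;
  the coefficient \<open>35\<close> keeps the sum above \<open>s\<close> on \<open>[0, 2]\<close>.\<close>

definition bellman :: "real \<Rightarrow> real \<Rightarrow> real" where
  "bellman s a = 35 * s - 17 * s\<^sup>2 + 16 * a * sqrt s"

lemma bellman_step:
  fixes s d a :: real
  assumes s: "0 < s" "s \<le> 1" and d: "\<bar>d\<bar> \<le> s" and a: "0 \<le> a"
  shows "(bellman (s + d) (a + d\<^sup>2) + bellman (s - d) (a + d\<^sup>2)) / 2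
    + ((a + d\<^sup>2)\<^sup>2 - a\<^sup>2) / s \<le> bellman s a"
proof -
  define D T R where "D = d\<^sup>2" and "T = (a + D) * ((sqrt (s + d) + sqrt (s - d)) / 2)"
    and "R = a * (D / (8 * s))"
  have D: "0 \<le> D" "D \<le> s\<^sup>2"
    using d by (auto simp: D_def abs_le_square_iff[symmetric])
  have "sqrt s \<le> 1"
    using s by simp
  have s32: "s * sqrt s \<le> s" "0 < s * sqrt s"
    using s mult_left_mono[OF \<open>sqrt s \<le> 1\<close>, of s] by auto
  have "(a + D) * ((sqrt (s + d) + sqrt (s - d)) / 2) \<le> (a + D) * (sqrt s - D / (8 * (s * sqrt s)))"
    using sqrt_midpoint[OF s(1) d] a D unfolding D_def by (intro mult_left_mono) auto
  also have "\<dots> = a * sqrt s - a * (D / (8 * (s * sqrt s))) + D * sqrt s - D * (D / (8 * (s * sqrt s)))"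
    by (simp add: algebra_simps add_divide_distrib)
  \<comment> \<open>As \<open>s \<le> 1\<close>, replacing \<open>s * sqrt s\<close> by
    \<open>s\<close> only weakens the concavity gain, and it makes \<open>16 * R\<close> equal to
    the part \<open>2 * a * D / s\<close> of the cost.\<close>
  also have "\<dots> \<le> a * sqrt s - a * (D / (8 * s)) + D - 0"
  proof -
    have "a * (D / (8 * s)) \<le> a * (D / (8 * (s * sqrt s)))"
      using s32 s a D by (intro mult_left_mono divide_left_mono) auto
    moreover have "D * sqrt s \<le> D"
      using \<open>sqrt s \<le> 1\<close> D mult_left_mono[of "sqrt s" 1 D] by simp
    moreover have "0 \<le> D * (D / (8 * (s * sqrt s)))"
      using D s by simp
    ultimately show ?thesis
      by linarith
  qed
  finally have T: "T \<le> a * sqrt s - R + D"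
    unfolding T_def R_def by simp
  have R: "((a + D)\<^sup>2 - a\<^sup>2) / s \<le> 16 * R + D"
  proof -
    have "D \<le> s"
      using D s mult_left_mono[of s 1 s] unfolding power2_eq_square by linarith
    then have "D * D \<le> D * s"
      using D by (intro mult_left_mono) auto
    then have "D\<^sup>2 / s \<le> D"
      using s by (simp add: pos_divide_le_eq power2_eq_square)
    moreover have "((a + D)\<^sup>2 - a\<^sup>2) / s = 16 * R + D\<^sup>2 / s"
      unfolding R_def by (simp add: power2_eq_square algebra_simps add_divide_distrib)
    ultimately show ?thesis
      by linarith
  qed
  \<comment> \<open>The coefficients balance exactly: \<open>16 * T\<close> contributes
    \<open>- 16 * R + 16 * D\<close>, the quadratic term \<open>- 17 * D\<close>, and the cost at
    most \<open>16 * R + D\<close>.\<close>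
  have "(bellman (s + d) (a + D) + bellman (s - d) (a + D)) / 2
      = 35 * s - 17 * s\<^sup>2 - 17 * D + 16 * T"
    unfolding bellman_def D_def T_def by (simp add: power2_eq_square field_simps)
  moreover have "bellman s a = 35 * s - 17 * s\<^sup>2 + 16 * (a * sqrt s)"
    by (simp add: bellman_def)
  ultimately show ?thesis
    using T R unfolding D_def by linarith
qed

text \<open>Here \<open>s\<close> and \<open>v\<close> stand for the averages of \<open>1/w\<close> and \<open>w\<close> over an interval, \<open>a\<close> for the
  square sum accumulated over its strict ancestors, and \<open>r\<^sup>2\<close> for the level. The first term is
  the Chebyshev bound for the square of the square sum.\<close>

definition bellman_bound :: "real \<Rightarrow> real \<Rightarrow> real \<Rightarrow> real \<Rightarrow> real \<Rightarrow> real" where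
  "bellman_bound Q r s v a = (a / r\<^sup>2)\<^sup>2 * v + Q / r * bellman (s / r) (a / r\<^sup>2)"

lemma bellman_ge:
  assumes "0 \<le> s" "s \<le> 2" "0 \<le> a"
  shows "s \<le> bellman s a"
proof -
  have "s * s \<le> s * 2"
    using assms by (intro mult_left_mono) auto
  then show ?thesis
    using assms unfolding bellman_def by (simp add: power2_eq_square add_increasing2)
qed

text \<open>The two summands serve the two ways to finish an interval. If \<open>a\<close> exceeds
  \<open>r\<^sup>2\<close>, the first is at least \<open>v\<close>; if \<open>s\<close> reaches
  \<open>r\<close>, the second dominates \<open>v\<close> by the \<open>A\<^sub>2\<close> condition.
  The range up to \<open>2 * r\<close> leaves room for a child whose parent has average below
  \<open>r\<close>.\<close>

lemma bellman_bound_ge: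
  assumes "0 \<le> s" "s \<le> 2 * r" "0 \<le> a" "0 < r" "0 \<le> Q"
  shows "(a / r\<^sup>2)\<^sup>2 * v + Q * s / r\<^sup>2 \<le> bellman_bound Q r s v a"
proof -
  have "s / r \<le> bellman (s / r) (a / r\<^sup>2)"
    using assms by (intro bellman_ge) (auto simp: field_simps)
  then have "Q / r * (s / r) \<le> Q / r * bellman (s / r) (a / r\<^sup>2)"
    using assms by (intro mult_left_mono) auto
  then show ?thesis
    by (simp add: bellman_bound_def power2_eq_square)
qed

lemma bellman_bound_nonneg:
  assumes "0 \<le> s" "s \<le> 2 * r" "0 \<le> a" "0 < r" "0 \<le> Q" "0 \<le> v"
  shows "0 \<le> bellman_bound Q r s v a"
proof -
  have "0 \<le> (a / r\<^sup>2)\<^sup>2 * v + Q * s / r\<^sup>2"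
    using assms by simp
  with bellman_bound_ge[OF assms(1-5)] show ?thesis
    by (rule order_trans[rotated])
qed

text \<open>This is \<open>bellman_step\<close> rescaled by \<open>r\<close> and multiplied by
  \<open>Q / r\<close>. The \<open>A\<^sub>2\<close> condition, read as
  \<open>v \<le> Q / s\<close>, bounds the growth of the Chebyshev summand by the cost term
  there.\<close>

lemma bellman_bound_step:
  assumes s: "0 \<le> s" "s \<le> r" and d: "\<bar>d\<bar> \<le> s" and a: "0 \<le> a" and r: "0 < r" and Q: "0 \<le> Q"
    and v: "(v1 + v2) / 2 * s \<le> Q"
  shows "(bellman_bound Q r (s - d) v1 (a + d\<^sup>2) + bellman_bound Q r (s + d) v2 (a + d\<^sup>2)) / 2
    \<le> bellman_bound Q r s ((v1 + v2) / 2) a"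
proof (cases "s = 0")
  case True
  \<comment> \<open>Here \<open>d = 0\<close>, and both sides agree because
    \<open>bellman_bound\<close> is affine in \<open>v\<close>.\<close>
  with d show ?thesis
    by (simp add: bellman_bound_def algebra_simps add_divide_distrib)
next
  case False
  then have s0: "0 < s"
    using s by simp
  define b e v where "b = a / r\<^sup>2" and "e = (d / r)\<^sup>2" and "v = (v1 + v2) / 2"
  have be: "0 \<le> b" "0 \<le> e" "(a + d\<^sup>2) / r\<^sup>2 = b + e"
    using a by (auto simp: b_def e_def power_divide add_divide_distrib)
  have "(bellman (s / r + d / r) (b + e) + bellman (s / r - d / r) (b + e)) / 2
      + ((b + e)\<^sup>2 - b\<^sup>2) / (s / r) \<le> bellman (s / r) b"
    using bellman_step[of "s / r" "d / r" b] s0 s d r be unfolding e_def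
    by (simp add: divide_right_mono abs_divide)
  then have "Q / r * ((bellman (s / r + d / r) (b + e) + bellman (s / r - d / r) (b + e)) / 2
      + ((b + e)\<^sup>2 - b\<^sup>2) / (s / r)) \<le> Q / r * bellman (s / r) b"
    using Q r by (intro mult_left_mono) auto
  moreover have "Q / r * (((b + e)\<^sup>2 - b\<^sup>2) / (s / r)) = Q / s * ((b + e)\<^sup>2 - b\<^sup>2)"
    using r by simp
  moreover have "v * ((b + e)\<^sup>2 - b\<^sup>2) \<le> Q / s * ((b + e)\<^sup>2 - b\<^sup>2)"
  proof (rule mult_right_mono)
    show "v \<le> Q / s"
      using v s0 by (simp add: v_def pos_le_divide_eq)
    show "0 \<le> (b + e)\<^sup>2 - b\<^sup>2"
      using be by (simp add: power_mono)
  qed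
  ultimately have "(b + e)\<^sup>2 * v
      + Q / r * ((bellman (s / r + d / r) (b + e) + bellman (s / r - d / r) (b + e)) / 2)
      \<le> b\<^sup>2 * v + Q / r * bellman (s / r) b"
    by (simp add: algebra_simps)
  moreover have "(bellman_bound Q r (s - d) v1 (a + d\<^sup>2) + bellman_bound Q r (s + d) v2 (a + d\<^sup>2)) / 2
      = (b + e)\<^sup>2 * v
        + Q / r * ((bellman (s / r + d / r) (b + e) + bellman (s / r - d / r) (b + e)) / 2)"
    unfolding bellman_bound_def be(3) v_def by (simp add: algebra_simps add_divide_distrib diff_divide_distrib)
  moreover have "bellman_bound Q r s ((v1 + v2) / 2) a = b\<^sup>2 * v + Q / r * bellman (s / r) b"
    by (simp add: bellman_bound_def b_def v_def)
  ultimately show ?thesis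
    by (simp only:)
qed

section \<open>The weak-type estimate\<close>

lemma locally_integrable_measurable:
  assumes "locally_integrable f"
  shows "f \<in> borel_measurable lebesgue"
proof (rule borel_measurable_LIMSEQ_real)
  fix x :: real
  obtain N :: nat where N: "\<bar>x\<bar> \<le> real N"
    using real_arch_simple by blast
  show "(\<lambda>n. indicator {- real n..real n} x *\<^sub>R f x) \<longlonglongrightarrow> f x"
  proof (rule tendsto_eventually, rule eventually_sequentiallyI)
    fix n assume "N \<le> n"
    then have "real N \<le> real n"
      by simp
    with N show "indicator {- real n..real n} x *\<^sub>R f x = f x"
      by (simp add: indicator_def abs_le_iff)
  qed
next
  fix n
  have "set_integrable lebesgue {- real n..real n} f"
    using assms unfolding locally_integrable_def by blast
  then show "(\<lambda>x. indicator {- real n..real n} x *\<^sub>R f x) \<in> borel_measurable lebesgue"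
    unfolding set_integrable_def by (rule borel_measurable_integrable)
qed

lemma locally_integrable_dyadic:
  assumes "locally_integrable f" "J \<in> dyadic_intervals"
  shows "set_integrable lebesgue J f"
proof -
  obtain a b where "J = {a..<b}"
    using assms(2) by (rule dyadic_interval)
  moreover have "set_integrable lebesgue {a..b} f"
    using assms(1) unfolding locally_integrable_def by blast
  ultimately show ?thesis
    by (auto intro: set_integrable_subset)
qed

lemma average_children:
  assumes f: "locally_integrable f" and J: "J \<in> dyadic_intervals"
  shows "average f J = (average f (child_minus J) + average f (child_plus J)) / 2"
proof -
  have "(LINT x:J|lebesgue. f x) = (LINT x:child_minus J|lebesgue. f x) + (LINT x:child_plus J|lebesgue. f x)"
    using set_integral_Un[OF children_partition(2)[OF J]] locally_integrable_dyadic[OF f]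
      children_dyadic[OF J] children_partition(1)[OF J] by metis
  then show ?thesis
    unfolding average_def
    by (simp add: measure_children[OF J] algebra_simps add_divide_distrib)
qed

lemma average_nonneg:
  assumes "\<And>x. 0 \<le> f x"
  shows "0 \<le> average f J"
  unfolding average_def set_lebesgue_integral_def
  using assms by (intro mult_nonneg_nonneg integral_nonneg) auto

text \<open>Reading the integral as a measure with density gives access to subadditivity and
  continuity from below.\<close>

lemma weighted_measure_eq_emeasure:
  assumes "locally_integrable w" "E \<in> sets lebesgue"
  shows "weighted_measure w E = emeasure (density lebesgue (\<lambda>x. ennreal (w x))) E"
  using locally_integrable_measurable[OF assms(1)] assms(2)
  by (simp add: weighted_measure_def emeasure_density)

lemma weighted_measure_mono: "E \<subseteq> F \<Longrightarrow> weighted_measure w E \<le> weighted_measure w F"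
  unfolding weighted_measure_def
  by (intro nn_integral_mono mult_left_mono) (auto simp: indicator_def)

lemma weighted_measure_Un_le:
  assumes "locally_integrable w" "E \<in> sets lebesgue" "F \<in> sets lebesgue"
  shows "weighted_measure w (E \<union> F) \<le> weighted_measure w E + weighted_measure w F"
  using assms by (simp add: weighted_measure_eq_emeasure emeasure_subadditive)

lemma weighted_measure_dyadic:
  assumes w: "locally_integrable w" "\<And>x. 0 \<le> w x" and J: "J \<in> dyadic_intervals"
  shows "weighted_measure w J = ennreal (measure lebesgue J * average w J)"
proof -
  have "weighted_measure w J = (\<integral>\<^sup>+x. ennreal (indicator J x *\<^sub>R w x) \<partial>lebesgue)"
    unfolding weighted_measure_def by (intro nn_integral_cong) (auto simp: indicator_def)
  also have "\<dots> = ennreal (LINT x:J|lebesgue. w x)"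
    unfolding set_lebesgue_integral_def
    using locally_integrable_dyadic[OF w(1) J] w(2)
    by (intro nn_integral_eq_integral) (auto simp: set_integrable_def)
  finally show ?thesis
    using dyadic_sets(3)[OF J] by (simp add: average_def)
qed

text \<open>Induction on the number of generations, with \<open>J\<close> and the accumulated sum
  \<open>a\<close> varying. Where the average of \<open>u\<close> reaches \<open>r\<close> the
  recursion stops; elsewhere it passes to both children with \<open>a + d\<^sup>2\<close>, and
  \<open>bellman_bound_step\<close> recombines their bounds.\<close>

lemma weak_type_partial_sum:
  fixes w :: "real \<Rightarrow> real"
  defines "u \<equiv> \<lambda>x. inverse (w x)"
  assumes w: "weight w" and Q: "0 \<le> Q"
    and A2: "\<And>J. J \<in> dyadic_intervals \<Longrightarrow> average w J * average u J \<le> Q"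
    and r: "0 < r" and J: "J \<in> dyadic_intervals" and a: "0 \<le> a" and le: "average u J \<le> 2 * r"
  shows "weighted_measure w {x \<in> J. a + partial_sum u N J x > r\<^sup>2}
    \<le> ennreal (measure lebesgue J * bellman_bound Q r (average u J) (average w J) a)"
  using J a le
proof (induction N arbitrary: J a)
  have li: "locally_integrable w" "locally_integrable u" and pos: "\<And>x. 0 \<le> w x" "\<And>x. 0 \<le> u x"
    using w unfolding weight_def u_def by (auto intro: less_imp_le)
  have nn: "0 \<le> average w J" "0 \<le> average u J" for J
    using pos by (auto intro: average_nonneg)
  {
    case (0 J a)
    let ?s = "average u J" and ?v = "average w J"
    show ?case
    proof (cases "a > r\<^sup>2")
      case True
      \<comment> \<open>Chebyshev: \<open>a / r\<^sup>2\<close> exceeds \<open>1\<close>, so the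
        first summand alone dominates \<open>v\<close>.\<close>
      then have "?v \<le> (a / r\<^sup>2)\<^sup>2 * ?v"
        using r nn(1)[of J] by (intro mult_le_cancel_right1[THEN iffD2]) (auto intro: one_le_power)
      also have "\<dots> \<le> bellman_bound Q r ?s ?v a"
        using bellman_bound_ge[OF nn(2) 0(3,2) r Q, of ?v] nn(2)[of J] Q by (auto intro: order_trans[rotated])
      finally have "measure lebesgue J * ?v \<le> measure lebesgue J * bellman_bound Q r ?s ?v a"
        by (intro mult_left_mono) auto
      then show ?thesis
        using weighted_measure_mono[of "{x \<in> J. a + partial_sum u 0 J x > r\<^sup>2}" J w]
          weighted_measure_dyadic[OF li(1) pos(1) 0(1)] by (auto intro: order_trans ennreal_leI)
    next
      case False
      then have "{x \<in> J. a + partial_sum u 0 J x > r\<^sup>2} = {}"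
        using generations_0[OF 0(1)] by (auto simp: partial_sum_def)
      then show ?thesis
        by (simp add: weighted_measure_def)
    qed
  next
    case (Suc N J a)
    let ?s = "average u J" and ?v = "average w J" and ?m = "measure lebesgue J"
    let ?E = "\<lambda>N J a. {x \<in> J. a + partial_sum u N J x > r\<^sup>2}"
    show ?case
    proof (cases "r \<le> ?s")
      case True
      \<comment> \<open>Stopping interval: the whole weight of \<open>J\<close> is charged to the
        summand \<open>Q * s / r\<^sup>2\<close>.\<close>
      have "?v \<le> Q / ?s"
        using A2[OF Suc.prems(1)] True r by (simp add: pos_le_divide_eq)
      also have "\<dots> \<le> Q * ?s / r\<^sup>2"
      proof -
        have "r\<^sup>2 \<le> ?s\<^sup>2"
          using True r by (intro power_mono) auto
        then have "Q * r\<^sup>2 \<le> Q * ?s\<^sup>2"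
          using Q by (intro mult_left_mono) auto
        then show ?thesis
          using True r by (simp add: field_simps power2_eq_square)
      qed
      also have "\<dots> \<le> bellman_bound Q r ?s ?v a"
        using bellman_bound_ge[OF nn(2) Suc.prems(3,2) r Q, of ?v] nn(1)[of J]
        by (auto intro: order_trans[rotated])
      finally have "?m * ?v \<le> ?m * bellman_bound Q r ?s ?v a"
        by (intro mult_left_mono) auto
      then show ?thesis
        using weighted_measure_mono[of "?E (Suc N) J a" J w]
          weighted_measure_dyadic[OF li(1) pos(1) Suc.prems(1)] by (auto intro: order_trans ennreal_leI)
    next
      case False
      let ?l = "child_minus J" and ?r = "child_plus J"
      define d where "d = (average u ?r - average u ?l) / 2"
      note ch = children_dyadic[OF Suc.prems(1)]
      note avg = average_children[OF li(1) Suc.prems(1)] average_children[OF li(2) Suc.prems(1)]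
      have sd: "average u ?l = ?s - d" "average u ?r = ?s + d"
        unfolding avg(2) d_def by (simp_all add: field_simps)
      have d: "\<bar>d\<bar> \<le> ?s"
        using nn(2)[of ?l] nn(2)[of ?r] unfolding sd by linarith
      have a': "0 \<le> a + d\<^sup>2"
        using Suc.prems(2) by simp
      \<comment> \<open>The bound \<open>2 * r\<close> survives the descent: the average over
        \<open>J\<close> is below \<open>r\<close>, and \<open>d\<close> is at most that average in
        modulus.\<close>
      have le: "average u ?l \<le> 2 * r" "average u ?r \<le> 2 * r"
        using d False unfolding sd by linarith+
      have [measurable]: "?l \<in> sets lebesgue" "?r \<in> sets lebesgue"
        using ch dyadic_sets(1) by auto
      note [measurable] = partial_sum_measurable[OF ch(1)] partial_sum_measurable[OF ch(2)]
      \<comment> \<open>On each child the truncated sum of its sibling vanishes, and the term of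
        \<open>J\<close> moves into the accumulated sum.\<close>
      have "?E (Suc N) J a \<subseteq> ?E N ?l (a + d\<^sup>2) \<union> ?E N ?r (a + d\<^sup>2)"
      proof
        fix x assume x: "x \<in> ?E (Suc N) J a"
        then have "x \<in> ?l \<and> x \<notin> ?r \<or> x \<notin> ?l \<and> x \<in> ?r"
          using children_partition[OF Suc.prems(1)] by blast
        then show "x \<in> ?E N ?l (a + d\<^sup>2) \<union> ?E N ?r (a + d\<^sup>2)"
          using x partial_sum_Suc[OF Suc.prems(1), of x u N]
            partial_sum_outside[of x ?l u N] partial_sum_outside[of x ?r u N]
          by (auto simp: d_def)
      qed
      then have "weighted_measure w (?E (Suc N) J a)
          \<le> weighted_measure w (?E N ?l (a + d\<^sup>2) \<union> ?E N ?r (a + d\<^sup>2))"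
        by (rule weighted_measure_mono)
      also have "\<dots> \<le> weighted_measure w (?E N ?l (a + d\<^sup>2)) + weighted_measure w (?E N ?r (a + d\<^sup>2))"
        by (rule weighted_measure_Un_le[OF li(1)]) measurable
      also have "\<dots> \<le> ennreal (?m / 2 * bellman_bound Q r (?s - d) (average w ?l) (a + d\<^sup>2))
          + ennreal (?m / 2 * bellman_bound Q r (?s + d) (average w ?r) (a + d\<^sup>2))"
        using Suc.IH[OF ch(1) a' le(1)] Suc.IH[OF ch(2) a' le(2)]
        unfolding measure_children[OF Suc.prems(1)] sd by (rule add_mono)
      also have "\<dots> = ennreal (?m * ((bellman_bound Q r (?s - d) (average w ?l) (a + d\<^sup>2)
          + bellman_bound Q r (?s + d) (average w ?r) (a + d\<^sup>2)) / 2))"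
        using bellman_bound_nonneg[OF nn(2) le(1) a' r Q nn(1)[of ?l]]
          bellman_bound_nonneg[OF nn(2) le(2) a' r Q nn(1)[of ?r]] unfolding sd
        by (subst ennreal_plus[symmetric]) (auto simp: algebra_simps add_divide_distrib)
      also have "\<dots> \<le> ennreal (?m * bellman_bound Q r ?s ?v a)"
        using bellman_bound_step[OF nn(2) _ d Suc.prems(2) r Q] False A2[OF Suc.prems(1)]
        unfolding avg(1) by (intro ennreal_leI mult_left_mono) auto
      finally show ?thesis .
    qed
  }
qed

lemma A2_char_leD:
  assumes "A2_char w \<le> ennreal Q" "0 \<le> Q" "J \<in> dyadic_intervals"
  shows "average w J * average (\<lambda>x. inverse (w x)) J \<le> Q"
proof -
  have "ennreal (average w J * average (\<lambda>x. inverse (w x)) J) \<le> ennreal Q"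
    using assms unfolding A2_char_def SUP_le_iff by blast
  then show ?thesis
    using assms(2) by (simp add: ennreal_le_iff)
qed

text \<open>With \<open>r\<close> the root of the level, an average of \<open>u\<close> up to
  \<open>2 * r\<close> is handled by the truncated estimate with \<open>a = 0\<close> and a limit in
  the depth; a larger average is handled by the \<open>A\<^sub>2\<close> condition on
  \<open>I\<close> itself.\<close>

lemma weak_type_estimate:
  fixes w :: "real \<Rightarrow> real"
  defines "u \<equiv> \<lambda>x. inverse (w x)"
  assumes w: "weight w" and A2: "A2_char w \<le> ennreal Q" and Q: "0 \<le> Q"
    and I: "I \<in> dyadic_intervals" and l: "0 < l"
  shows "weighted_measure w {x \<in> I. square_sum u I x > ennreal l} / emeasure lebesgue I
    \<le> ennreal (35 * Q * (average u I / l))"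
proof -
  define r where "r = sqrt l"
  have r: "0 < r" "r\<^sup>2 = l"
    using l by (auto simp: r_def)
  have li: "locally_integrable w" "locally_integrable u" and pos: "\<And>x. 0 \<le> w x" "\<And>x. 0 \<le> u x"
    using w unfolding weight_def u_def by (auto intro: less_imp_le)
  have A2': "average w J * average u J \<le> Q" if "J \<in> dyadic_intervals" for J
    using A2_char_leD[OF A2 Q that] by (simp add: u_def)
  have [measurable]: "I \<in> sets lebesgue"
    using I by (rule dyadic_sets)
  note [measurable] = partial_sum_measurable[OF I]
  let ?s = "average u I" and ?v = "average w I" and ?m = "measure lebesgue I"
  let ?E = "{x \<in> I. square_sum u I x > ennreal l}"
  have nn: "0 \<le> ?s" "0 \<le> ?v"
    using pos by (auto intro: average_nonneg)
  have m: "0 < ?m"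
    using I by (rule dyadic_sets)
  have "weighted_measure w ?E \<le> ennreal (?m * (35 * Q * (?s / l)))"
  proof (cases "?s \<le> 2 * r")
    case True
    define E where "E N = {x \<in> I. partial_sum u N I x > l}" for N
    have E: "E N \<in> sets lebesgue" for N
      unfolding E_def by measurable
    have "incseq E"
    proof (rule incseq_SucI, rule subsetI)
      fix N x assume "x \<in> E N"
      moreover have "partial_sum u N I x \<le> partial_sum u (Suc N) I x"
        unfolding partial_sum_def
        using finite_generations[OF I] generations_mono[of N "Suc N" I] by (intro sum_mono2) auto
      ultimately show "x \<in> E (Suc N)"
        by (auto simp: E_def)
    qed
    \<comment> \<open>The constant \<open>35\<close> is the linear coefficient of
      \<open>bellman\<close>: for \<open>a = 0\<close> only a nonpositive quadratic term accompanies
      it.\<close>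
    have "bellman_bound Q r ?s ?v 0 \<le> 35 * Q * (?s / l)"
    proof -
      have "Q / r * bellman (?s / r) 0 \<le> Q / r * (35 * (?s / r))"
        using Q r by (intro mult_left_mono) (auto simp: bellman_def)
      also have "\<dots> = 35 * Q * (?s / l)"
        using r by (simp add: power2_eq_square[symmetric])
      finally show ?thesis
        by (simp add: bellman_bound_def)
    qed
    then have bd: "?m * bellman_bound Q r ?s ?v 0 \<le> ?m * (35 * Q * (?s / l))"
      using m by (intro mult_left_mono) auto
    have "weighted_measure w (E N) \<le> ennreal (?m * (35 * Q * (?s / l)))" for N
      using weak_type_partial_sum[OF w Q A2'[unfolded u_def] r(1) I order_refl True[unfolded u_def], of N]
        ennreal_leI[OF bd]
      unfolding E_def r(2) u_def by (auto intro: order_trans)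
    \<comment> \<open>Continuity from below is applied to the measurable sets \<open>E N\<close>;
      the level set itself enters only through this inclusion.\<close>
    moreover have "?E \<subseteq> (\<Union>N. E N)"
      using square_sum_gt_imp[OF I less_imp_le[OF l]] by (fastforce simp: E_def)
    then have "weighted_measure w ?E \<le> weighted_measure w (\<Union>N. E N)"
      by (rule weighted_measure_mono)
    moreover have "weighted_measure w (\<Union>N. E N) = (SUP N. weighted_measure w (E N))"
      using E \<open>incseq E\<close> SUP_emeasure_incseq[of E "density lebesgue (\<lambda>x. ennreal (w x))"]
      by (simp add: weighted_measure_eq_emeasure[OF li(1)] image_subset_iff sets.countable_UN)
    ultimately show ?thesis
      by (simp add: SUP_least order_trans)
  next
    case False
    then have s: "r \<le> ?s" "0 < ?s"
      using r by auto
    \<comment> \<open>The average now exceeds the root of the level, so the whole weight of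
      \<open>I\<close> fits the bound, even with constant \<open>1\<close> in place of
      \<open>35\<close>.\<close>
    have "?v \<le> Q / ?s"
      using A2'[OF I] s by (simp add: pos_le_divide_eq)
    also have "\<dots> \<le> 35 * Q * (?s / l)"
    proof -
      have "l \<le> ?s\<^sup>2"
        using power_mono[OF s(1), of 2] r by simp
      then have "Q * l \<le> Q * (35 * ?s\<^sup>2)"
        using Q l by (intro mult_left_mono) auto
      then show ?thesis
        using s l by (simp add: field_simps power2_eq_square)
    qed
    finally have "?m * ?v \<le> ?m * (35 * Q * (?s / l))"
      using m by (intro mult_left_mono) auto
    then show ?thesis
      using weighted_measure_mono[of ?E I w] weighted_measure_dyadic[OF li(1) pos(1) I]
      by (auto intro: order_trans ennreal_leI)
  qed
  then have "weighted_measure w ?E / emeasure lebesgue I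
      \<le> ennreal (?m * (35 * Q * (?s / l))) / ennreal ?m"
    unfolding dyadic_sets(4)[OF I] by (rule divide_right_mono_ennreal)
  also have "\<dots> = ennreal (35 * Q * (?s / l))"
    using m nn Q l by (subst divide_ennreal) auto
  finally show ?thesis .
qed

section \<open>Sharpness\<close>

definition step_weight :: "real \<Rightarrow> real \<Rightarrow> real \<Rightarrow> real" where
  "step_weight p q x = (if x < 1/2 then p else q)"

lemma step_weight_integrable:
  assumes "K \<in> lmeasurable"
  shows "set_integrable lebesgue K (step_weight p q)"
    and "(LINT x:K|lebesgue. step_weight p q x)
      = p * measure lebesgue (K \<inter> {..<1/2}) + q * (measure lebesgue K - measure lebesgue (K \<inter> {..<1/2}))"
proof -
  let ?A = "K \<inter> {..<1/2}" and ?B = "K - {..<1/2}"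
  have sets: "K \<in> sets lebesgue" "?A \<in> lmeasurable" "?B \<in> lmeasurable"
    using assms by (auto intro: fmeasurable_Int_fmeasurable fmeasurable_Diff)
  have int: "has_bochner_integral lebesgue (\<lambda>x. p * indicator ?A x + q * indicator ?B x)
      (p * measure lebesgue ?A + q * measure lebesgue ?B)"
    using sets by (intro has_bochner_integral_add has_bochner_integral_mult_right
        has_bochner_integral_real_indicator) (auto simp: fmeasurable_def)
  have eq: "(\<lambda>x. indicator K x *\<^sub>R step_weight p q x) = (\<lambda>x. p * indicator ?A x + q * indicator ?B x)"
    by (auto simp: step_weight_def indicator_def)
  have "measure lebesgue ?B = measure lebesgue K - measure lebesgue ?A"
    using measurable_measure_Diff[of K lebesgue ?A] sets assms
    by (auto simp: Diff_Int)
  with int show "set_integrable lebesgue K (step_weight p q)"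
    "(LINT x:K|lebesgue. step_weight p q x)
      = p * measure lebesgue ?A + q * (measure lebesgue K - measure lebesgue ?A)"
    unfolding set_integrable_def set_lebesgue_integral_def eq
    by (auto simp: has_bochner_integral_iff)
qed

lemma inverse_step_weight: "(\<lambda>x. inverse (step_weight p q x)) = step_weight (inverse p) (inverse q)"
  by (auto simp: step_weight_def)

lemma weight_step_weight:
  assumes "0 < p" "0 < q"
  shows "weight (step_weight p q)"
  unfolding weight_def locally_integrable_def inverse_step_weight
  using assms by (auto simp: step_weight_def intro: step_weight_integrable lmeasurable_compact)

lemma average_step_weight:
  assumes "J \<in> dyadic_intervals"
  defines "\<theta> \<equiv> measure lebesgue (J \<inter> {..<1/2}) / measure lebesgue J"
  shows "average (step_weight p q) J = p * \<theta> + q * (1 - \<theta>)"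
proof -
  have "J \<in> lmeasurable"
    using dyadic_sets[OF assms(1)] by (intro fmeasurableI) simp_all
  then show ?thesis
    using dyadic_sets(3)[OF assms(1)] unfolding average_def \<theta>_def
    by (simp add: step_weight_integrable(2) field_simps)
qed

text \<open>The weight and its reciprocal take values at most \<open>t\<close>, hence so do all
  their averages; this crude bound on the product is enough.\<close>

lemma A2_char_step_weight:
  assumes "1 \<le> t"
  shows "A2_char (step_weight t (1/t)) \<le> ennreal (t\<^sup>2)"
  unfolding A2_char_def
proof (rule SUP_least)
  fix J assume J: "J \<in> dyadic_intervals"
  define h where "h = measure lebesgue (J \<inter> {..<1/2}) / measure lebesgue J"
  have "measure lebesgue (J \<inter> {..<1/2}) \<le> measure lebesgue J"
    using dyadic_sets[OF J] by (intro measure_mono_fmeasurable fmeasurableI) auto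
  then have h: "0 \<le> h" "h \<le> 1"
    using dyadic_sets(3)[OF J] by (simp_all add: h_def)
  have t: "1 / t \<le> t"
    using assms mult_mono[of 1 t 1 t] by (simp add: field_simps)
  have "average (step_weight t (1/t)) J * average (step_weight (inverse t) (inverse (1/t))) J
      = (t * h + 1/t * (1 - h)) * (1/t * h + t * (1 - h))"
    unfolding average_step_weight[OF J] h_def by (simp add: inverse_eq_divide)
  also have "\<dots> \<le> (t * h + t * (1 - h)) * (t * h + t * (1 - h))"
    using h t assms by (intro mult_mono add_mono mult_right_mono add_nonneg_nonneg) auto
  also have "\<dots> = t\<^sup>2"
    by (simp add: power2_eq_square algebra_simps)
  finally show "ennreal (average (step_weight t (1/t)) J * average (\<lambda>x. inverse (step_weight t (1/t) x)) J)
      \<le> ennreal (t\<^sup>2)"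
    unfolding inverse_step_weight by (rule ennreal_leI)
qed

lemma unit_interval:
  "{0..<1} \<in> dyadic_intervals" "child_minus {0..<1} = {0..<1/2}" "child_plus {0..<1} = {1/2..<1}"
proof -
  show "{0..<1} \<in> dyadic_intervals"
    unfolding dyadic_intervals_def by (intro CollectI exI[of _ 0]) simp
qed (simp_all add: child_minus_def child_plus_def)

text \<open>For the step weight with \<open>t\<^sup>2 = Q\<close>, the top martingale difference on
  the unit interval already exceeds the level \<open>Q / 17\<close> everywhere, so the level set is
  the whole interval.\<close>

lemma C_wT_lower_bound:
  assumes Q: "2 \<le> Q"
  shows "ennreal (Q / 17) \<le> C_wT Q"
  unfolding C_wT_def
proof (rule Inf_greatest, clarify)
  fix C assume C: "\<forall>w. weight w \<and> A2_char w \<le> ennreal Q \<longrightarrow>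
      (\<forall>I\<in>dyadic_intervals. \<forall>l>0. weak_type_bound C w I l)"
  define t where "t = sqrt Q"
  have t: "1 \<le> t" "t\<^sup>2 = Q"
    using Q by (auto simp: t_def)
  define w where "w = step_weight t (1/t)"
  define u where "u = step_weight (1/t) t"
  define m where "m = (t + 1/t) / 2"
  let ?I = "{0..<1} :: real set"
  have u: "(\<lambda>x. inverse (w x)) = u"
    unfolding w_def u_def inverse_step_weight by (simp add: inverse_eq_divide)
  have w: "weight w" "A2_char w \<le> ennreal Q"
    using t weight_step_weight[of t "1/t"] A2_char_step_weight[OF t(1)] by (auto simp: w_def)
  have li: "locally_integrable w" "\<And>x. 0 \<le> w x"
    using w(1) by (auto simp: weight_def intro: less_imp_le)
  note ch = children_dyadic[OF unit_interval(1), unfolded unit_interval(2,3)]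
  have sets: "?I \<inter> {..<1/2} = {0..<1/2}" "{0..<1/2} \<inter> {..<1/2::real} = {0..<1/2}" "{1/2..<1} \<inter> {..<1/2::real} = {}"
    by auto
  have avg: "average w ?I = (t + 1/t) / 2" "average u ?I = (t + 1/t) / 2"
    "average u {0..<1/2} = 1/t" "average u {1/2..<1} = t"
    unfolding w_def u_def average_step_weight[OF unit_interval(1)] average_step_weight[OF ch(1)]
      average_step_weight[OF ch(2)] sets by (simp_all add: field_simps)
  have "square_sum u ?I x > ennreal (Q / 17)" if x: "x \<in> ?I" for x
  proof -
    \<comment> \<open>This uses \<open>2 \<le> Q\<close>. It makes the squared difference at least
      \<open>Q / 16\<close>; the level \<open>Q / 17\<close> lies strictly below.\<close>
    have "1 / t \<le> t / 2"
      using t Q by (simp add: field_simps power2_eq_square)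
    then have "(t / 4)\<^sup>2 \<le> ((t - 1/t) / 2)\<^sup>2"
      using t by (intro power_mono) auto
    then have "Q / 17 < ((t - 1/t) / 2)\<^sup>2"
      using t Q by (simp add: power_divide)
    also have "\<dots> = \<bar>mart_diff u ?I x\<bar>\<^sup>2 * indicator ?I x"
      using x by (auto simp: mart_diff_def unit_interval avg indicator_def power2_eq_square field_simps)
    finally have "ennreal (Q / 17) < ennreal (\<bar>mart_diff u ?I x\<bar>\<^sup>2 * indicator ?I x)"
      using Q by (subst ennreal_less_iff) auto
    then show ?thesis
      using square_sum_ge[OF unit_interval(1), of u x] by (rule less_le_trans)
  qed
  then have E: "{x \<in> ?I. square_sum u ?I x > ennreal (Q / 17)} = ?I"
    by auto
  have "weak_type_bound C w ?I (Q / 17)"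
    using C w unit_interval(1) Q by simp
  \<comment> \<open>By symmetry \<open>w\<close> and \<open>u\<close> have the same average
    \<open>m\<close> over the unit interval, so \<open>m\<close> cancels and the level remains as
    lower bound for \<open>C\<close>.\<close>
  then have le: "ennreal m \<le> C * ennreal (m / (Q / 17))"
    unfolding weak_type_bound_def u E weighted_measure_dyadic[OF li unit_interval(1)] avg m_def
    by (simp add: divide_ennreal_def)
  have m: "0 < m"
    using t by (auto simp: m_def intro: add_pos_pos)
  show "ennreal (Q / 17) \<le> C"
  proof (cases C)
    case (real c)
    have "m \<le> c * (m / (Q / 17))"
      using le real m Q by (simp add: ennreal_mult[symmetric] ennreal_le_iff)
    then have "m * Q \<le> m * (17 * c)"
      using Q by (simp add: field_simps)
    then have "Q \<le> 17 * c"
      using m by simp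
    then have "Q / 17 \<le> c"
      using Q by simp
    then show ?thesis
      using real by (simp add: ennreal_leI)
  qed simp
qed

theorem theorem4p1:
  "(\<exists>A::real. 0 < A \<and>
      (\<forall>Q\<ge>1. C_wT Q \<le> ennreal (A * Q) \<and>
        (\<forall>w. weight w \<and> A2_char w \<le> ennreal Q \<longrightarrow>
          (\<forall>I\<in>dyadic_intervals. \<forall>l>0.
            weighted_measure w {x \<in> I. square_sum (\<lambda>x. inverse (w x)) I x > ennreal l}
              / emeasure lebesgue I
            \<le> ennreal (A * Q * (average (\<lambda>x. inverse (w x)) I / l)))))) \<and>
   (\<exists>c::real. 0 < c \<and> (\<forall>\<^sub>F Q in at_top. ennreal (c * Q) \<le> C_wT Q))"
proof (rule conjI[OF exI[of _ "35::real"] exI[of _ "1/17::real"]]; intro conjI allI impI ballI)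
  fix Q :: real assume Q: "1 \<le> Q"
  show "C_wT Q \<le> ennreal (35 * Q)"
    unfolding C_wT_def
  proof (rule Inf_lower, clarify)
    fix w and I :: "real set" and l :: real
    assume *: "weight w" "A2_char w \<le> ennreal Q" "I \<in> dyadic_intervals" "0 < l"
    then have "0 \<le> average (\<lambda>x. inverse (w x)) I"
      by (intro average_nonneg) (auto simp: weight_def intro: less_imp_le)
    then show "weak_type_bound (ennreal (35 * Q)) w I l"
      using weak_type_estimate[OF *(1,2) _ *(3,4)] Q \<open>0 < l\<close>
      unfolding weak_type_bound_def by (simp add: ennreal_mult[symmetric])
  qed
next
  fix Q l :: real and w :: "real \<Rightarrow> real" and I :: "real set"
  assume "1 \<le> Q" "weight w \<and> A2_char w \<le> ennreal Q" "I \<in> dyadic_intervals" "0 < l"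
  then show "weighted_measure w {x \<in> I. square_sum (\<lambda>x. inverse (w x)) I x > ennreal l} / emeasure lebesgue I
      \<le> ennreal (35 * Q * (average (\<lambda>x. inverse (w x)) I / l))"
    using weak_type_estimate[of w Q I l] by simp
next
  show "\<forall>\<^sub>F Q in at_top. ennreal (1/17 * Q) \<le> C_wT Q"
    by (rule eventually_mono[OF eventually_ge_at_top[of "2::real"]]) (use C_wT_lower_bound in simp)
qed simp_all

end
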